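(* (Type 1) Suppose that, conditionally on $\mathbf{X}$, $Y$ has a density of the one-parameter exponential family form $f_{Y|X}(y;\theta)=\exp(y\theta-b(\theta)+c(y))$, $\theta=\theta(\mathbf{X})$, for known functions $b(\cdot)$ and $c(\cdot)$ such that $b''$ exists. If $b''$ is strictly positive and continuous, then the negative log-likelihood loss $l(\omega,Y)=-[\omega Y-b(\omega)+c(Y)]$ is a conditional strictly convex loss function. (Type 2) Suppose $Y\in\{-1,1\}$ and $P(Y=1|\mathbf{X}=\mathbf{x})=p(\mathbf{x})$. Then the exponential loss $l(\omega,Y)=\exp(-Y\omega)$ is a conditional strictly convex loss function. (Type 3) Let $0<\tau<1$. If the conditional distribution of $Y$ given $\mathbf{X}$ has a continuous density function $f_{Y|X}$ with $f_{Y|X}>0$ on any bounded domain, then the quantile regression loss $l(\omega,Y)=(Y-\omega)\{\tau-\mathbf{I}(Y-\omega<0)\}$ ($\mathbf{I}$ the indicator function) is a conditional strictly convex loss function.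
   Context: $Y$ is a real response variable and $\mathbf{X}=(X_1,\dots,X_p)^T$ a covariate vector. A loss is a function $l(x,y):\mathbb{R}\times\mathbb{R}\to\mathbb{R}$, convex in $x$, whose partial derivative $\partial l(x,y)/\partial x$ exists for almost every $x$. The distribution of $Y$ depends on a parameter $\theta=\theta(\mathbf{X})$, and it is a standing assumption that the true $\theta$ minimizes $E[l(\omega,Y)|\mathbf{X}]$ with respect to $\omega$ (in particular this conditional expectation is well defined). Definition: $l(\omega,Y)$ is called a conditional strictly convex loss function if $\partial E[l(\omega,Y)|\mathbf{X}]/\partial\omega$ is continuously differentiable in $\omega$ and $\partial^2E[l(\omega,Y)|\mathbf{X}]/\partial\omega^2>0$. *)

theory Defs
  imports "HOL-Probability.Probability"
begin

text \<open>Losses \<open>l x y\<close>, with the fitted value \<open>x\<close> first and the response \<open>y\<close> second.\<close>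

definition loss_function :: "(real \<Rightarrow> real \<Rightarrow> real) \<Rightarrow> bool" where
  "loss_function l \<longleftrightarrow>
     (\<forall>y. convex_on UNIV (\<lambda>x. l x y) \<and> (AE x in lborel. (\<lambda>x. l x y) differentiable (at x)))"

text \<open>\<open>K\<close> is a regular conditional distribution of \<open>Y\<close> given \<open>X\<close>. On the real line one always
  exists, and it is unique up to a null set of the distribution of \<open>X\<close>; this is why all
  conditions on \<open>K x\<close> below are imposed for almost every \<open>x\<close> only.\<close>

definition regular_cond_distr ::
  "'w measure \<Rightarrow> ('w \<Rightarrow> 'x::topological_space) \<Rightarrow> ('w \<Rightarrow> real) \<Rightarrow> ('x \<Rightarrow> real measure) \<Rightarrow> bool" where
  "regular_cond_distr M X Y K \<longleftrightarrow>
     K \<in> borel \<rightarrow>\<^sub>M prob_algebra borel \<and>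
     (\<forall>A\<in>sets borel. \<forall>B\<in>sets borel.
        emeasure M {s \<in> space M. X s \<in> A \<and> Y s \<in> B}
          = (\<integral>\<^sup>+x\<in>A. emeasure (K x) B \<partial>distr M borel X))"

text \<open>The conditional risk \<open>E[l(\<omega>,Y) | X = x]\<close>, as a function of \<open>\<omega>\<close>. Taking the integral against
  the regular conditional distribution fixes one version for all \<open>\<omega>\<close> simultaneously, so that
  differentiating in \<open>\<omega>\<close> makes sense. Lemma \<open>real_cond_exp_eq_cond_risk\<close> below shows that it
  is a version of the conditional expectation.\<close>

definition cond_risk ::
  "('x \<Rightarrow> real measure) \<Rightarrow> (real \<Rightarrow> real \<Rightarrow> real) \<Rightarrow> 'x \<Rightarrow> real \<Rightarrow> real" where
  "cond_risk K l x \<omega> = (\<integral>y. l \<omega> y \<partial>K x)"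

definition true_parameter ::
  "'w measure \<Rightarrow> ('w \<Rightarrow> 'x::topological_space) \<Rightarrow> ('x \<Rightarrow> real measure) \<Rightarrow>
     (real \<Rightarrow> real \<Rightarrow> real) \<Rightarrow> ('x \<Rightarrow> real) \<Rightarrow> bool" where
  "true_parameter M X K l \<theta> \<longleftrightarrow>
     (AE x in distr M borel X.
        (\<forall>\<omega>. integrable (K x) (l \<omega>)) \<and>
        (\<forall>\<omega>. cond_risk K l x (\<theta> x) \<le> cond_risk K l x \<omega>))"

text \<open>Integrability is part of the definition because the Bochner integral of a non-integrable
  function is \<open>0\<close> by convention.\<close>

definition cond_strictly_convex_loss ::
  "'w measure \<Rightarrow> ('w \<Rightarrow> 'x::topological_space) \<Rightarrow> ('x \<Rightarrow> real measure) \<Rightarrow>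
     (real \<Rightarrow> real \<Rightarrow> real) \<Rightarrow> bool" where
  "cond_strictly_convex_loss M X K l \<longleftrightarrow>
     loss_function l \<and>
     (AE x in distr M borel X.
        (\<forall>\<omega>. integrable (K x) (l \<omega>)) \<and>
        (\<exists>R' R''.
           (\<forall>\<omega>. (cond_risk K l x has_real_derivative R' \<omega>) (at \<omega>)) \<and>
           (\<forall>\<omega>. (R' has_real_derivative R'' \<omega>) (at \<omega>)) \<and>
           continuous_on UNIV R'' \<and>
           (\<forall>\<omega>. R'' \<omega> > 0)))"

definition exp_family_nll :: "(real \<Rightarrow> real) \<Rightarrow> (real \<Rightarrow> real) \<Rightarrow> real \<Rightarrow> real \<Rightarrow> real" where
  "exp_family_nll b c \<omega> y = - (\<omega> * y - b \<omega> + c y)"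

definition exponential_loss :: "real \<Rightarrow> real \<Rightarrow> real" where
  "exponential_loss \<omega> y = exp (- y * \<omega>)"

definition quantile_loss :: "real \<Rightarrow> real \<Rightarrow> real \<Rightarrow> real" where
  "quantile_loss \<tau> \<omega> y = (y - \<omega>) * (\<tau> - indicat_real {..<0} (y - \<omega>))"

lemma nn_set_integral_regular_cond_distr:
  fixes X :: "'w \<Rightarrow> 'x::topological_space"
  assumes [measurable]: "X \<in> borel_measurable M" "Y \<in> borel_measurable M"
    and K: "regular_cond_distr M X Y K"
    and [measurable]: "g \<in> borel_measurable borel" "A \<in> sets borel"
  shows "(\<integral>\<^sup>+s. g (Y s) * indicator A (X s) \<partial>M)
           = (\<integral>\<^sup>+s. (\<integral>\<^sup>+y. g y \<partial>K (X s)) * indicator A (X s) \<partial>M)"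
proof -
  have Ks [measurable]: "K \<in> borel \<rightarrow>\<^sub>M subprob_algebra borel"
    using K unfolding regular_cond_distr_def by (auto intro: measurable_prob_algebraD)
  define N where "N = density (distr M borel X) (indicator A)"
  have Ns [simp, measurable_cong]: "sets N = sets borel" and [simp]: "space N = UNIV"
    by (simp_all add: N_def)
  have KN [measurable]: "K \<in> N \<rightarrow>\<^sub>M subprob_algebra borel" by measurable
  have eq: "distr (density M (\<lambda>s. indicator A (X s))) borel Y = N \<bind> K"
  proof (rule measure_eqI)
    show "sets (distr (density M (\<lambda>s. indicator A (X s))) borel Y) = sets (N \<bind> K)"
      by (subst sets_bind[OF sets_kernel[OF KN]]) auto
  next
    fix B assume "B \<in> sets (distr (density M (\<lambda>s. indicator A (X s))) borel Y)"
    then have B [measurable]: "B \<in> sets borel" by simp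
    have "emeasure (distr (density M (\<lambda>s. indicator A (X s))) borel Y) B
        = (\<integral>\<^sup>+s. indicator A (X s) * indicator (Y -` B \<inter> space M) s \<partial>M)"
      by (simp add: emeasure_distr emeasure_density)
    also have "\<dots> = (\<integral>\<^sup>+s. indicator {s \<in> space M. X s \<in> A \<and> Y s \<in> B} s \<partial>M)"
      by (intro nn_integral_cong) (auto split: split_indicator)
    also have "\<dots> = emeasure M {s \<in> space M. X s \<in> A \<and> Y s \<in> B}"
      by (intro nn_integral_indicator) measurable
    also have "\<dots> = (\<integral>\<^sup>+x\<in>A. emeasure (K x) B \<partial>distr M borel X)"
      using K B assms(5) unfolding regular_cond_distr_def by blast
    also have "\<dots> = (\<integral>\<^sup>+x. emeasure (K x) B \<partial>N)"
      unfolding N_def by (subst nn_integral_density) (auto simp: mult.commute)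
    also have "\<dots> = emeasure (N \<bind> K) B"
      by (subst emeasure_bind[OF _ KN B]) auto
    finally show "emeasure (distr (density M (\<lambda>s. indicator A (X s))) borel Y) B
        = emeasure (N \<bind> K) B" .
  qed
  have "(\<integral>\<^sup>+s. g (Y s) * indicator A (X s) \<partial>M)
      = (\<integral>\<^sup>+y. g y \<partial>distr (density M (\<lambda>s. indicator A (X s))) borel Y)"
    by (subst nn_integral_distr, simp, simp, subst nn_integral_density)
       (auto simp: mult.commute)
  also have "\<dots> = (\<integral>\<^sup>+x. \<integral>\<^sup>+y. g y \<partial>K x \<partial>N)"
    unfolding eq by (rule nn_integral_bind[OF assms(4) KN])
  also have "\<dots> = (\<integral>\<^sup>+s. (\<integral>\<^sup>+y. g y \<partial>K (X s)) * indicator A (X s) \<partial>M)"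
    unfolding N_def
    by (subst nn_integral_density, simp, measurable, subst nn_integral_distr)
       (auto simp: mult.commute)
  finally show ?thesis .
qed

lemma real_cond_exp_eq_cond_risk:
  fixes X :: "'w \<Rightarrow> 'x::topological_space"
  assumes M: "prob_space M"
    and X [measurable]: "X \<in> borel_measurable M" and Y [measurable]: "Y \<in> borel_measurable M"
    and K: "regular_cond_distr M X Y K"
    and int: "AE x in distr M borel X. integrable (K x) (l \<omega>)"
    and l [measurable]: "l \<omega> \<in> borel_measurable borel"
  shows "AE s in M. real_cond_exp M (vimage_algebra (space M) X borel) (\<lambda>s. l \<omega> (Y s)) s
           = cond_risk K l (X s) \<omega>"
proof -
  let ?F = "vimage_algebra (space M) X borel"
  interpret prob_space M by fact
  have sub: "subalgebra M ?F"
    unfolding subalgebra_def by (auto simp: sets_vimage_algebra2 intro!: measurable_sets[OF X])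
  interpret finite_measure_subalgebra M ?F
    by unfold_locales (rule sub)
  have XF [measurable]: "X \<in> ?F \<rightarrow>\<^sub>M borel" by (rule measurable_vimage_algebra1) auto
  have Ks [measurable]: "K \<in> borel \<rightarrow>\<^sub>M subprob_algebra borel"
    using K unfolding regular_cond_distr_def by (auto intro: measurable_prob_algebraD)
  have nn: "AE s in M. (\<integral>\<^sup>+y. g y \<partial>K (X s)) = nn_cond_exp M ?F (\<lambda>s. g (Y s)) s"
    if [measurable]: "g \<in> borel_measurable borel" for g :: "real \<Rightarrow> ennreal"
  proof (rule nn_cond_exp_charact)
    fix A assume "A \<in> sets ?F"
    then obtain C where C: "C \<in> sets borel" "A = X -` C \<inter> space M"
      by (auto simp: sets_vimage_algebra2)
    have "(\<integral>\<^sup>+s\<in>A. g (Y s) \<partial>M) = (\<integral>\<^sup>+s. g (Y s) * indicator C (X s) \<partial>M)"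
      unfolding C by (intro nn_integral_cong) (auto split: split_indicator)
    also have "\<dots> = (\<integral>\<^sup>+s. (\<integral>\<^sup>+y. g y \<partial>K (X s)) * indicator C (X s) \<partial>M)"
      by (rule nn_set_integral_regular_cond_distr[OF X Y K that C(1)])
    also have "\<dots> = (\<integral>\<^sup>+s\<in>A. (\<integral>\<^sup>+y. g y \<partial>K (X s)) \<partial>M)"
      unfolding C by (intro nn_integral_cong) (auto split: split_indicator)
    finally show "(\<integral>\<^sup>+s\<in>A. g (Y s) \<partial>M) = (\<integral>\<^sup>+s\<in>A. (\<integral>\<^sup>+y. g y \<partial>K (X s)) \<partial>M)" .
  qed measurable
  have "AE s in M. integrable (K (X s)) (l \<omega>)"
    by (rule AE_distrD[OF X int])
  then show ?thesis
    using nn[of "\<lambda>y. ennreal (l \<omega> y)", simplified] nn[of "\<lambda>y. ennreal (- l \<omega> y)", simplified]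
  proof eventually_elim
    case (elim s)
    then show ?case
      by (simp add: real_cond_exp_def cond_risk_def real_lebesgue_integral_def)
  qed
qed

end

theory Submission
  imports Defs
begin

text \<open>
  For the exponential family the risk is \<open>b\<close> plus an affine function; for the exponential loss it is
  a positive combination of \<open>exp (- \<omega>)\<close> and \<open>exp \<omega>\<close>, hence its own second derivative. For the
  quantile loss, \<open>1{y < \<omega>} - \<tau>\<close> is a subgradient in \<open>\<omega>\<close>; integrating the subgradient inequality
  shows that \<open>F \<omega> - \<tau>\<close>, with \<open>F\<close> the conditional distribution function, is a subgradient of the
  risk, and a continuous subgradient is a derivative. The second derivative is then the density.
\<close>

section \<open>Regular conditional distributions\<close>

lemma regular_cond_distr_kernel:
  assumes "regular_cond_distr M X Y K"
  shows "prob_space (K x)" "sets (K x) = sets borel"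
proof -
  have "K \<in> borel \<rightarrow>\<^sub>M prob_algebra borel"
    using assms by (simp add: regular_cond_distr_def)
  then have "K x \<in> space (prob_algebra borel)"
    by (rule measurable_space) simp
  then show "prob_space (K x)" "sets (K x) = sets borel"
    by (auto simp: space_prob_algebra)
qed

text \<open>Transfers support information from \<open>Y\<close> to the kernel. Taking
  \<open>A = UNIV\<close> in the defining identity, the mean of \<open>emeasure (K x) (- B)\<close>
  over the law of \<open>X\<close> is the measure of the event that \<open>Y\<close> misses
  \<open>B\<close>, hence 0; a nonnegative function with zero integral vanishes almost
  everywhere.\<close>

lemma AE_regular_cond_distr:
  fixes X :: "'w \<Rightarrow> 'x::topological_space"
  assumes K: "regular_cond_distr M X Y K"
    and [measurable]: "X \<in> borel_measurable M" "Y \<in> borel_measurable M" "B \<in> sets borel"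
    and Y: "AE s in M. Y s \<in> B"
  shows "AE x in distr M borel X. AE y in K x. y \<in> B"
proof -
  have Ks [measurable]: "K \<in> borel \<rightarrow>\<^sub>M subprob_algebra borel"
    using K unfolding regular_cond_distr_def by (auto intro: measurable_prob_algebraD)
  have eq: "\<forall>A\<in>sets borel. \<forall>B\<in>sets borel.
      emeasure M {s \<in> space M. X s \<in> A \<and> Y s \<in> B}
        = (\<integral>\<^sup>+x\<in>A. emeasure (K x) B \<partial>distr M borel X)"
    using K unfolding regular_cond_distr_def by blast
  have "(\<integral>\<^sup>+x\<in>UNIV. emeasure (K x) (- B) \<partial>distr M borel X)
      = emeasure M {s \<in> space M. X s \<in> UNIV \<and> Y s \<in> - B}"
    by (rule sym, rule eq[rule_format]) auto
  also have "\<dots> = 0"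
    using Y by (subst (asm) AE_iff_measurable[OF _ refl]) auto
  finally have "AE x in distr M borel X. emeasure (K x) (- B) = 0"
    by (subst (asm) nn_integral_0_iff_AE) auto
  then show ?thesis
  proof eventually_elim
    case (elim x)
    have [measurable_cong]: "sets (K x) = sets borel"
      by (rule regular_cond_distr_kernel(2)[OF K])
    show ?case
      using elim by (intro AE_I[where N = "- B"]) auto
  qed
qed

section \<open>Subgradients on the real line\<close>

text \<open>Let \<open>z\<close> be the convex combination of \<open>x\<close> and \<open>y\<close>.
  The inequalities at \<open>z\<close> towards \<open>x\<close> and towards \<open>y\<close>,
  weighted by \<open>1 - t\<close> and \<open>t\<close>, add up to convexity, because the linear
  terms cancel.\<close>

lemma subgradient_imp_convex_on:
  fixes R G :: "real \<Rightarrow> real"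
  assumes "\<And>a b. G a * (b - a) \<le> R b - R a"
  shows "convex_on UNIV R"
proof (rule convex_onI)
  fix t x y :: real assume t: "0 < t" "t < 1"
  define z where "z = (1 - t) * x + t * y"
  have "(1 - t) * (G z * (x - z)) + t * (G z * (y - z)) \<le> (1 - t) * (R x - R z) + t * (R y - R z)"
    using t assms by (intro add_mono mult_left_mono) auto
  moreover have "(1 - t) * (G z * (x - z)) + t * (G z * (y - z)) = 0"
    unfolding z_def by algebra
  ultimately show "R ((1 - t) *\<^sub>R x + t *\<^sub>R y) \<le> (1 - t) * R x + t * R y"
    by (simp add: z_def algebra_simps)
qed simp

text \<open>The inequalities based at \<open>a\<close> and at \<open>b\<close> together trap the
  difference quotient between \<open>G a\<close> and \<open>G b\<close>. Continuity of
  \<open>G\<close> at \<open>a\<close> then forces the quotient to converge to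
  \<open>G a\<close>.\<close>

lemma continuous_subgradient_imp_has_derivative:
  fixes R G :: "real \<Rightarrow> real"
  assumes G: "\<And>a b. G a * (b - a) \<le> R b - R a" and cont: "isCont G a"
  shows "(R has_real_derivative G a) (at a)"
proof -
  have "\<bar>(R b - R a) / (b - a) - G a\<bar> \<le> \<bar>G b - G a\<bar>" if "b \<noteq> a" for b
  proof -
    have "\<bar>R b - R a - G a * (b - a)\<bar> \<le> \<bar>(G b - G a) * (b - a)\<bar>"
      using G[of a b] G[of b a] by (simp add: algebra_simps)
    moreover have "(R b - R a) / (b - a) - G a = (R b - R a - G a * (b - a)) / (b - a)"
      using that by (simp add: diff_divide_distrib)
    ultimately show ?thesis
      using that by (simp add: abs_mult pos_divide_le_eq)
  qed
  then have "\<forall>\<^sub>F b in at a. norm ((R b - R a) / (b - a) - G a) \<le> \<bar>G b - G a\<bar>"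
    by (simp add: eventually_at_filter)
  moreover have "((\<lambda>b. \<bar>G b - G a\<bar>) \<longlongrightarrow> 0) (at a)"
    using cont by (intro tendsto_rabs_zero) (simp add: isCont_def LIM_zero)
  ultimately have "((\<lambda>b. (R b - R a) / (b - a) - G a) \<longlongrightarrow> 0) (at a)"
    by (rule Lim_null_comparison)
  then show ?thesis
    by (simp add: has_field_derivative_iff LIM_zero_iff)
qed

section \<open>Differentiating a distribution function\<close>

lemma measure_density_lessThan_has_derivative:
  fixes f :: "real \<Rightarrow> real"
  assumes cont: "continuous_on UNIV f" and nonneg: "\<And>y. 0 \<le> f y"
    and fin: "finite_measure (density lborel f)"
  shows "((\<lambda>t. measure (density lborel f) {..<t}) has_real_derivative f a) (at a)"
proof -
  interpret finite_measure "density lborel f" by fact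
  have [measurable]: "f \<in> borel_measurable borel"
    by (rule borel_measurable_continuous_onI[OF cont])
  \<comment> \<open>The mass of the half-line is split at \<open>a - 1\<close>: the part to the left
    is constant in \<open>t\<close>, and the rest is an integral over a compact interval, to which
    the fundamental theorem of calculus applies. The base point lies strictly left of
    \<open>a\<close>, so that \<open>a\<close> is an interior point and the derivative is
    two-sided.\<close>
  have eq: "measure (density lborel f) {..<t}
      = measure (density lborel f) {..<a - 1} + integral {a - 1..t} f" if "t \<ge> a - 1" for t
  proof -
    have f_int: "set_integrable lborel {a - 1..t} f"
      using cont by (intro borel_integrable_atLeastAtMost') (rule continuous_on_subset, auto)
    \<comment> \<open>The two intervals differ only in the point \<open>t\<close>, a Lebesgue null
      set.\<close>
    have "emeasure (density lborel f) {a - 1..<t} = emeasure (density lborel f) {a - 1..t}"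
      using AE_lborel_singleton[of t]
      by (auto simp: emeasure_density intro!: nn_integral_cong_AE elim!: eventually_mono
               split: split_indicator)
    also have "\<dots> = ennreal (LINT y:{a - 1..t}|lborel. f y)"
      using f_int nonneg unfolding set_integrable_def set_lebesgue_integral_def
      by (subst nn_integral_eq_integral[symmetric])
         (auto simp: emeasure_density mult.commute ennreal_mult' ennreal_indicator
               intro!: nn_integral_cong)
    also have "(LINT y:{a - 1..t}|lborel. f y) = integral {a - 1..t} f"
      using f_int by (rule set_borel_integral_eq_integral(2))
    finally have "measure (density lborel f) {a - 1..<t} = integral {a - 1..t} f"
      using nonneg by (simp add: measure_def integral_nonneg_AE Henstock_Kurzweil_Integration.integral_nonneg
            integrable_continuous_interval continuous_on_subset[OF cont])
    moreover have "{..<t} = {..<a - 1} \<union> {a - 1..<t}"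
      using that by auto
    moreover have "measure (density lborel f) ({..<a - 1} \<union> {a - 1..<t})
        = measure (density lborel f) {..<a - 1} + measure (density lborel f) {a - 1..<t}"
      by (rule finite_measure_Union) auto
    ultimately show ?thesis
      by simp
  qed
  have D: "((\<lambda>t. measure (density lborel f) {..<a - 1} + integral {a - 1..t} f)
      has_real_derivative f a) (at a)"
  proof -
    have "((\<lambda>t. integral {a - 1..t} f) has_real_derivative f a) (at a within {a - 1..a + 1})"
      by (rule integral_has_real_derivative[OF continuous_on_subset[OF cont]]) auto
    then have "((\<lambda>t. integral {a - 1..t} f) has_real_derivative f a) (at a)"
      by (subst (asm) at_within_interior) auto
    then show ?thesis
      by (auto intro!: derivative_eq_intros)
  qed
  \<comment> \<open>The split formula is available only for \<open>t \<ge> a - 1\<close>, but a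
    derivative at \<open>a\<close> depends only on values near \<open>a\<close>.\<close>
  have "eventually (\<lambda>t. a - 1 < t) (nhds a)"
    by (rule eventually_nhds_in_open[of "{a - 1<..}" a, simplified])
  then have "eventually (\<lambda>t. measure (density lborel f) {..<t}
      = measure (density lborel f) {..<a - 1} + integral {a - 1..t} f) (nhds a)"
    by (rule eventually_mono) (intro eq, simp)
  from DERIV_cong_ev[OF refl this refl] D show ?thesis
    by (rule iffD2)
qed

section \<open>Convexity and almost everywhere differentiability of the three losses\<close>

lemma loss_function_exp_family_nll:
  assumes b: "\<And>t. (b has_real_derivative b' t) (at t)"
    and b': "\<And>t. (b' has_real_derivative b'' t) (at t)"
    and "\<And>t. b'' t \<ge> 0"
  shows "loss_function (exp_family_nll b c)"
proof -
  have D: "((\<lambda>\<omega>. exp_family_nll b c \<omega> y) has_real_derivative b' t - y) (at t)" for t y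
    unfolding exp_family_nll_def using b by (auto intro!: derivative_eq_intros)
  have "convex_on UNIV (\<lambda>\<omega>. exp_family_nll b c \<omega> y)" for y
    by (rule f''_ge0_imp_convex[where f' = "\<lambda>t. b' t - y" and f'' = b''])
       (use assms D in \<open>auto intro!: derivative_eq_intros\<close>)
  with D show ?thesis
    unfolding loss_function_def by (auto simp: real_differentiable_def)
qed

lemma loss_function_exponential: "loss_function exponential_loss"
proof -
  have D: "((\<lambda>\<omega>. exponential_loss \<omega> y) has_real_derivative - y * exp (- y * t)) (at t)" for t y
    unfolding exponential_loss_def by (auto intro!: derivative_eq_intros)
  have "convex_on UNIV (\<lambda>\<omega>. exponential_loss \<omega> y)" for y
    by (rule f''_ge0_imp_convex[where f' = "\<lambda>t. - y * exp (- y * t)"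
          and f'' = "\<lambda>t. y * y * exp (- y * t)"])
       (use D in \<open>auto intro!: derivative_eq_intros\<close>)
  with D show ?thesis
    unfolding loss_function_def by (auto simp: real_differentiable_def)
qed

text \<open>The right side minus the left side is \<open>y - b\<close> times the difference of the
  indicators of \<open>y < a\<close> and \<open>y < b\<close>. The indicators differ only if
  \<open>a \<le> y < b\<close> or \<open>b \<le> y < a\<close>, and in both cases the product is
  nonnegative.\<close>

lemma quantile_loss_subgradient:
  "(indicat_real {..<a} y - \<tau>) * (b - a) \<le> quantile_loss \<tau> b y - quantile_loss \<tau> a y"
proof -
  let ?i = "\<lambda>c. indicat_real {..<c} y"
  have loss: "quantile_loss \<tau> c y = (y - c) * (\<tau> - ?i c)" for c
    by (auto simp: quantile_loss_def split: split_indicator)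
  have "0 \<le> (y - b) * (?i a - ?i b)"
    by (auto split: split_indicator)
  also have "\<dots> = (y - b) * (\<tau> - ?i b) - (y - a) * (\<tau> - ?i a) - (?i a - \<tau>) * (b - a)"
    by algebra
  finally show ?thesis
    unfolding loss by simp
qed

lemma loss_function_quantile: "loss_function (quantile_loss \<tau>)"
proof -
  have "(\<lambda>\<omega>. quantile_loss \<tau> \<omega> y) differentiable (at t)" if "t \<noteq> y" for t y
  proof -
    have "((\<lambda>\<omega>. quantile_loss \<tau> \<omega> y) has_real_derivative indicat_real {..<t} y - \<tau>) (at t)"
    proof (rule continuous_subgradient_imp_has_derivative)
      show "(indicat_real {..<a} y - \<tau>) * (b - a) \<le> quantile_loss \<tau> b y - quantile_loss \<tau> a y"
        for a b by (rule quantile_loss_subgradient)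
      \<comment> \<open>For fixed \<open>y\<close> the indicator is read as a function of the fitted
        value. It jumps only at \<open>y\<close>, so away from the kink the subgradient is
        continuous and therefore a derivative.\<close>
      have "isCont (indicat_real {y<..}) t"
        using that by (simp add: isCont_indicator)
      moreover have "indicat_real {..<a} y = indicat_real {y<..} a" for a
        by (auto split: split_indicator)
      ultimately show "isCont (\<lambda>a. indicat_real {..<a} y - \<tau>) t"
        by (simp add: continuous_diff)
    qed
    then show ?thesis by (auto simp: real_differentiable_def)
  qed
  moreover have "convex_on UNIV (\<lambda>\<omega>. quantile_loss \<tau> \<omega> y)" for y
    by (rule subgradient_imp_convex_on[OF quantile_loss_subgradient])
  ultimately show ?thesis
    unfolding loss_function_def
    by (auto intro: eventually_mono[OF AE_lborel_singleton])
qed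

section \<open>The conditional risk of each type\<close>

lemma cond_strictly_convex_loss_exp_family_nll:
  assumes K: "regular_cond_distr M X Y K"
    and par: "true_parameter M X K (exp_family_nll b c) \<theta>"
    and b: "\<And>t. (b has_real_derivative b' t) (at t)"
    and b': "\<And>t. (b' has_real_derivative b'' t) (at t)"
    and pos: "\<And>t. b'' t > 0" and cont: "continuous_on UNIV b''"
  shows "cond_strictly_convex_loss M X K (exp_family_nll b c)"
  unfolding cond_strictly_convex_loss_def
proof
  show "loss_function (exp_family_nll b c)"
    using b b' less_imp_le[OF pos] by (rule loss_function_exp_family_nll)
  let ?l = "exp_family_nll b c"
  show "AE x in distr M borel X. (\<forall>\<omega>. integrable (K x) (?l \<omega>)) \<and>
        (\<exists>R' R''. (\<forall>\<omega>. (cond_risk K ?l x has_real_derivative R' \<omega>) (at \<omega>)) \<and>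
           (\<forall>\<omega>. (R' has_real_derivative R'' \<omega>) (at \<omega>)) \<and>
           continuous_on UNIV R'' \<and> (\<forall>\<omega>. R'' \<omega> > 0))"
    using par unfolding true_parameter_def
  proof eventually_elim
    case (elim x)
    interpret prob_space "K x" by (rule regular_cond_distr_kernel(1)[OF K])
    have l_int: "integrable (K x) (?l \<omega>)" for \<omega> using elim by blast
    \<comment> \<open>Integrability of the response is extracted from that of the loss: subtracting
      the losses at 0 and 1 cancels \<open>c y\<close>, and the added constant leaves exactly
      \<open>y\<close>.\<close>
    have "integrable (K x) (\<lambda>y. ?l 0 y - ?l 1 y + (b 1 - b 0))"
      by (intro Bochner_Integration.integrable_add Bochner_Integration.integrable_diff l_int) simp_all
    then have y_int: "integrable (K x) (\<lambda>y. y)"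
      by (simp add: exp_family_nll_def)
    \<comment> \<open>\<open>m\<close> is the conditional mean. The integral of \<open>c\<close> is
      absorbed into the risk at 0, so \<open>c\<close> need not be treated separately.\<close>
    define m R\<^sub>0 where "m = (\<integral>y. y \<partial>K x)" and "R\<^sub>0 = cond_risk K ?l x 0"
    have "cond_risk K ?l x \<omega> = R\<^sub>0 + (b \<omega> - b 0) - \<omega> * m" for \<omega>
    proof -
      have "?l \<omega> = (\<lambda>y. ?l 0 y + (b \<omega> - b 0) - \<omega> * y)"
        by (simp add: exp_family_nll_def fun_eq_iff)
      then have "cond_risk K ?l x \<omega> = (\<integral>y. ?l 0 y + (b \<omega> - b 0) - \<omega> * y \<partial>K x)"
        unfolding cond_risk_def by (rule arg_cong)
      also have "\<dots> = R\<^sub>0 + (b \<omega> - b 0) - \<omega> * m"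
        using l_int[of 0] y_int by (simp add: cond_risk_def m_def R\<^sub>0_def prob_space)
      finally show ?thesis .
    qed
    then have risk: "cond_risk K ?l x = (\<lambda>\<omega>. R\<^sub>0 + (b \<omega> - b 0) - \<omega> * m)"
      by blast
    then have "(cond_risk K ?l x has_real_derivative b' \<omega> - m) (at \<omega>)" for \<omega>
      unfolding risk using b by (auto intro!: derivative_eq_intros)
    moreover have "((\<lambda>\<omega>. b' \<omega> - m) has_real_derivative b'' \<omega>) (at \<omega>)" for \<omega>
      using b' by (auto intro!: derivative_eq_intros)
    ultimately show ?case
      using l_int pos cont
      by (intro conjI exI[of _ "\<lambda>\<omega>. b' \<omega> - m"] exI[of _ b'']) auto
  qed
qed

text \<open>Almost every conditional law lives on two points, where the loss takes the values
  \<open>exp (- \<omega>)\<close> and \<open>exp \<omega>\<close>. This gives integrability and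
  reduces the risk to a two-term sum.\<close>

lemma cond_strictly_convex_loss_exponential:
  fixes X :: "'w \<Rightarrow> 'x::topological_space"
  assumes K: "regular_cond_distr M X Y K"
    and X: "X \<in> borel_measurable M" and Y: "Y \<in> borel_measurable M"
    and Y_range: "AE s in M. Y s \<in> {-1, 1}"
  shows "cond_strictly_convex_loss M X K exponential_loss"
  unfolding cond_strictly_convex_loss_def
proof
  show "loss_function exponential_loss"
    by (rule loss_function_exponential)
  let ?l = exponential_loss
  have "AE x in distr M borel X. AE y in K x. y \<in> {-1, 1}"
    by (rule AE_regular_cond_distr[OF K X Y _ Y_range]) simp
  then show "AE x in distr M borel X. (\<forall>\<omega>. integrable (K x) (?l \<omega>)) \<and>
        (\<exists>R' R''. (\<forall>\<omega>. (cond_risk K ?l x has_real_derivative R' \<omega>) (at \<omega>)) \<and>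
           (\<forall>\<omega>. (R' has_real_derivative R'' \<omega>) (at \<omega>)) \<and>
           continuous_on UNIV R'' \<and> (\<forall>\<omega>. R'' \<omega> > 0))"
  proof eventually_elim
    case (elim x)
    interpret prob_space "K x" by (rule regular_cond_distr_kernel(1)[OF K])
    have [measurable_cong]: "sets (K x) = sets borel"
      by (rule regular_cond_distr_kernel(2)[OF K])
    have [simp]: "space (K x) = UNIV"
      using sets_eq_imp_space_eq[of "K x" borel] \<open>sets (K x) = sets borel\<close> by simp
    have [measurable]: "?l \<omega> \<in> borel_measurable borel" for \<omega>
      unfolding exponential_loss_def by measurable
    define p q where "p = prob {1}" and "q = prob {-1}"
    \<comment> \<open>A combination of indicators that agrees with the loss on the support, so that
      integrating over \<open>y\<close> only produces the two point masses.\<close>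
    let ?g = "\<lambda>\<omega> y. exp (- \<omega>) * indicat_real {1} y + exp \<omega> * indicat_real {-1} y"
    have l_eq: "AE y in K x. ?l \<omega> y = ?g \<omega> y" for \<omega>
      using elim by eventually_elim (auto simp: exponential_loss_def)
    have g_int: "integrable (K x) (?g \<omega>)" for \<omega>
      by (intro Bochner_Integration.integrable_add integrable_mult_right)
         (auto simp: less_top[symmetric])
    have l_int: "integrable (K x) (?l \<omega>)" for \<omega>
      using g_int[of \<omega>] l_eq[of \<omega>] by (subst integrable_cong_AE) auto
    have "cond_risk K ?l x \<omega> = p * exp (- \<omega>) + q * exp \<omega>" for \<omega>
    proof -
      have "cond_risk K ?l x \<omega> = (\<integral>y. ?g \<omega> y \<partial>K x)"
        unfolding cond_risk_def using l_eq[of \<omega>] by (intro integral_cong_AE) auto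
      also have "\<dots> = p * exp (- \<omega>) + q * exp \<omega>"
        by (subst Bochner_Integration.integral_add)
           (auto simp: p_def q_def less_top[symmetric] intro!: integrable_mult_right)
      finally show ?thesis .
    qed
    then have risk: "cond_risk K ?l x = (\<lambda>\<omega>. p * exp (- \<omega>) + q * exp \<omega>)"
      by blast
    \<comment> \<open>The weights are nonnegative and sum to 1, so at least one is positive. The
      degenerate laws, with all mass at one point, are thereby included.\<close>
    have "p + q = prob {1, -1}"
      unfolding p_def q_def by (subst finite_measure_Union[symmetric]) (auto simp: insert_commute)
    also have "\<dots> = 1"
      using elim by (subst prob_eq_1) (auto elim!: eventually_mono)
    finally have "p > 0 \<or> q > 0"
      by (auto simp: not_less)
    moreover have "p \<ge> 0" "q \<ge> 0"
      by (auto simp: p_def q_def)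
    ultimately have pos: "p * exp (- \<omega>) + q * exp \<omega> > 0" for \<omega>
      by (auto intro: add_pos_nonneg add_nonneg_pos)
    have "(cond_risk K ?l x has_real_derivative - p * exp (- \<omega>) + q * exp \<omega>) (at \<omega>)" for \<omega>
      unfolding risk by (auto intro!: derivative_eq_intros)
    moreover have "((\<lambda>\<omega>. - p * exp (- \<omega>) + q * exp \<omega>) has_real_derivative
        p * exp (- \<omega>) + q * exp \<omega>) (at \<omega>)" for \<omega>
      by (auto intro!: derivative_eq_intros)
    moreover have "continuous_on UNIV (\<lambda>\<omega>. p * exp (- \<omega>) + q * exp \<omega>)"
      by (intro continuous_intros)
    ultimately show ?case
      using l_int pos by (intro conjI exI[of _ "\<lambda>\<omega>. - p * exp (- \<omega>) + q * exp \<omega>"]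
          exI[of _ "\<lambda>\<omega>. p * exp (- \<omega>) + q * exp \<omega>"]) auto
  qed
qed

text \<open>For fixed \<open>y\<close> the loss has a kink, which averaging over a continuous
  density smooths out. Integrating the subgradient inequality replaces differentiation under the
  integral sign.\<close>

lemma cond_strictly_convex_loss_quantile:
  fixes X :: "'w \<Rightarrow> 'x::topological_space"
  assumes K: "regular_cond_distr M X Y K"
    and dens: "AE x in distr M borel X.
      K x = density lborel (\<lambda>y. ennreal (f x y)) \<and> continuous_on UNIV (f x) \<and> (\<forall>y. f x y > 0)"
    and par: "true_parameter M X K (quantile_loss \<tau>) \<theta>"
  shows "cond_strictly_convex_loss M X K (quantile_loss \<tau>)"
  unfolding cond_strictly_convex_loss_def
proof
  show "loss_function (quantile_loss \<tau>)"
    by (rule loss_function_quantile)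
  let ?l = "quantile_loss \<tau>"
  show "AE x in distr M borel X. (\<forall>\<omega>. integrable (K x) (?l \<omega>)) \<and>
        (\<exists>R' R''. (\<forall>\<omega>. (cond_risk K ?l x has_real_derivative R' \<omega>) (at \<omega>)) \<and>
           (\<forall>\<omega>. (R' has_real_derivative R'' \<omega>) (at \<omega>)) \<and>
           continuous_on UNIV R'' \<and> (\<forall>\<omega>. R'' \<omega> > 0))"
    using par[unfolded true_parameter_def] dens
  proof eventually_elim
    case (elim x)
    interpret prob_space "K x" by (rule regular_cond_distr_kernel(1)[OF K])
    have [measurable_cong]: "sets (K x) = sets borel"
      by (rule regular_cond_distr_kernel(2)[OF K])
    have Kx: "K x = density lborel (f x)" and cont: "continuous_on UNIV (f x)"
      and pos: "\<And>y. f x y > 0" and l_int: "\<And>\<omega>. integrable (K x) (?l \<omega>)"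
      using elim by auto
    \<comment> \<open>The strict half-line matches the strict indicator in the pointwise
      subgradient, so \<open>G \<omega>\<close> is exactly the integral of that subgradient.\<close>
    define G where "G \<omega> = prob {..<\<omega>} - \<tau>" for \<omega>
    have G: "(G has_real_derivative f x \<omega>) (at \<omega>)" for \<omega>
    proof -
      have "((\<lambda>\<omega>. prob {..<\<omega>}) has_real_derivative f x \<omega>) (at \<omega>)"
        using measure_density_lessThan_has_derivative[OF cont less_imp_le[OF pos]]
          finite_measure_axioms unfolding Kx by blast
      then show ?thesis
        unfolding G_def by (auto intro!: derivative_eq_intros)
    qed
    have "G a * (b - a) \<le> cond_risk K ?l x b - cond_risk K ?l x a" for a b
    proof -
      have ind_int: "integrable (K x) (indicat_real {..<a})"
        by (auto simp: less_top[symmetric])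
      have "G a * (b - a) = (\<integral>y. (indicat_real {..<a} y - \<tau>) * (b - a) \<partial>K x)"
        using ind_int by (simp add: G_def prob_space)
      also have "\<dots> \<le> (\<integral>y. ?l b y - ?l a y \<partial>K x)"
        using ind_int l_int by (intro integral_mono quantile_loss_subgradient) auto
      also have "\<dots> = cond_risk K ?l x b - cond_risk K ?l x a"
        using l_int by (simp add: cond_risk_def)
      finally show ?thesis .
    qed
    then have "(cond_risk K ?l x has_real_derivative G \<omega>) (at \<omega>)" for \<omega>
      by (rule continuous_subgradient_imp_has_derivative) (rule DERIV_isCont[OF G])
    then show ?case
      using l_int G cont pos by blast
  qed
qed

section \<open>The three types together\<close>

text \<open>In Type 1 the reference measure \<nu> is an arbitrary sigma-finite Borel measure, so
  that discrete families such as the Poisson are covered along with continuous ones.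
  \<open>true_parameter\<close> is the standing assumption on \<theta>.\<close>

theorem proposition2p1p1:
  fixes M :: "'w measure"
    and X :: "'w \<Rightarrow> real ^ 'p"
    and Y :: "'w \<Rightarrow> real"
    and K :: "real ^ 'p \<Rightarrow> real measure"
  assumes "prob_space M"
    and "X \<in> borel_measurable M"
    and "Y \<in> borel_measurable M"
    and "regular_cond_distr M X Y K"
  shows "(\<forall>(\<nu> :: real measure) (b :: real \<Rightarrow> real) (b' :: real \<Rightarrow> real) (b'' :: real \<Rightarrow> real)
            (c :: real \<Rightarrow> real) (\<theta> :: real ^ 'p \<Rightarrow> real).
            sigma_finite_measure \<nu> \<and> sets \<nu> = sets borel \<and> c \<in> borel_measurable borel \<and>
            (AE x in distr M borel X.
               K x = density \<nu> (\<lambda>y. ennreal (exp (y * \<theta> x - b (\<theta> x) + c y)))) \<and>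
            true_parameter M X K (exp_family_nll b c) \<theta> \<and>
            (\<forall>t. (b has_real_derivative b' t) (at t)) \<and>
            (\<forall>t. (b' has_real_derivative b'' t) (at t)) \<and>
            (\<forall>t. b'' t > 0) \<and> continuous_on UNIV b''
            \<longrightarrow> cond_strictly_convex_loss M X K (exp_family_nll b c))
       \<and> (\<forall>(p :: real ^ 'p \<Rightarrow> real) (\<theta> :: real ^ 'p \<Rightarrow> real).
            (AE s in M. Y s \<in> {-1, 1}) \<and>
            (AE x in distr M borel X. measure (K x) {1} = p x) \<and>
            true_parameter M X K exponential_loss \<theta>
            \<longrightarrow> cond_strictly_convex_loss M X K exponential_loss)
       \<and> (\<forall>(\<tau> :: real) (f :: real ^ 'p \<Rightarrow> real \<Rightarrow> real) (\<theta> :: real ^ 'p \<Rightarrow> real).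
            0 < \<tau> \<and> \<tau> < 1 \<and>
            (AE x in distr M borel X.
               K x = density lborel (\<lambda>y. ennreal (f x y)) \<and>
               continuous_on UNIV (f x) \<and>
               (\<forall>B. bounded B \<longrightarrow> (\<forall>y\<in>B. f x y > 0))) \<and>
            true_parameter M X K (quantile_loss \<tau>) \<theta>
            \<longrightarrow> cond_strictly_convex_loss M X K (quantile_loss \<tau>))"
proof (intro conjI allI impI; elim conjE)
  fix \<nu> :: "real measure" and b b' b'' c \<theta>
  assume "true_parameter M X K (exp_family_nll b c) \<theta>"
    "\<forall>t. (b has_real_derivative b' t) (at t)" "\<forall>t. (b' has_real_derivative b'' t) (at t)"
    "\<forall>t. b'' t > 0" "continuous_on UNIV b''"
  then show "cond_strictly_convex_loss M X K (exp_family_nll b c)"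
    by (intro cond_strictly_convex_loss_exp_family_nll[OF assms(4)]) auto
next
  assume "AE s in M. Y s \<in> {-1, 1}"
  then show "cond_strictly_convex_loss M X K exponential_loss"
    by (rule cond_strictly_convex_loss_exponential[OF assms(4,2,3)])
next
  fix \<tau> :: real and f \<theta>
  assume dens: "AE x in distr M borel X.
      K x = density lborel (\<lambda>y. ennreal (f x y)) \<and> continuous_on UNIV (f x) \<and>
      (\<forall>B. bounded B \<longrightarrow> (\<forall>y\<in>B. f x y > 0))"
    and par: "true_parameter M X K (quantile_loss \<tau>) \<theta>"
  \<comment> \<open>Each singleton is bounded, so positivity on bounded sets is positivity at every
    point.\<close>
  have "AE x in distr M borel X.
      K x = density lborel (\<lambda>y. ennreal (f x y)) \<and> continuous_on UNIV (f x) \<and> (\<forall>y. f x y > 0)"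
    using dens by eventually_elim (auto dest: spec[of _ "{y}" for y])
  from cond_strictly_convex_loss_quantile[OF assms(4) this par]
  show "cond_strictly_convex_loss M X K (quantile_loss \<tau>)" .
qed

end
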